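(* Let $K=\{x\in\{0,1\}^n \mid Ax\le b\}$ be a totally-ordered multiple knapsack set and let $\{C_1,\ldots,C_k\}$ be a multi-cover for $K$. Then every multi-cover inequality (MCI) $\alpha^T x\le\beta$ associated with $\{C_1,\ldots,C_k\}$ is valid for $\operatorname{conv}(K)$, i.e. it is satisfied by every $x\in\operatorname{conv}(K)$.
   Context: Notation: $[n]=\{1,\ldots,n\}$; for a vector $\alpha\in\mathbb{R}^n$ and $S\subseteq[n]$, $\alpha(S)=\sum_{i\in S}\alpha_i$; $\chi^S$ is the incidence vector of $S$. Totally-ordered multiple knapsack set (TOMKS): a set $K=\{x\in\{0,1\}^n\mid Ax\le b\}$ where $A\in\mathbb{Z}_+^{m\times n}$, $b\in\mathbb{Z}_+^m$ (nonnegative integer entries), and the columns of $A$ form a chain in the componentwise order, indexed so that $A_{\cdot1}\ge A_{\cdot2}\ge\cdots\ge A_{\cdot n}$. A set $S\subseteq[n]$ is a cover for $K$ if $\chi^S\notin K$. Dominance: for $S_1,S_2\subseteq[n]$, $S_1$ dominates $S_2$ (written $S_1\triangleright S_2$) if there is an injective function $f:S_2\to S_1$ with $f(i)\le i$ for all $i\in S_2$. Given a finite nonempty family $\mathscr{C}=\{C_1,\ldots,C_k\}$ of covers for $K$, let $C_0=\bigcap_{h=1}^kC_h$, $C=\bigcup_{h=1}^kC_h$, $\bar C_h=C\setminus C_h$. The discrepancy family is $\mathcal{D}(\mathscr{C})=\{C_1\setminus C_0,\ldots,C_k\setminus C_0\}$. The family $\mathscr{C}$ is a multi-cover for $K$ if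 for every $T\subseteq\bigcup_{D\in\mathcal{D}(\mathscr{C})}D$ with $T\notin\mathcal{D}(\mathscr{C})$ there is $D'\in\mathcal{D}(\mathscr{C})$ with $T\triangleright D'$ or $D'\triangleright T$. Multi-cover inequality (MCI): given a multi-cover $\{C_1,\ldots,C_k\}$, write $C\setminus C_0=\{i_1<\cdots<i_r\}$. An MCI associated with the multi-cover is any inequality $\alpha^Tx\le\beta$ produced as follows (a maximum or minimum over an empty set is taken to be $0$): $\alpha_i=0$ for $i\notin C$; $\alpha_{i_r}=1$; successively for $t=r-1,\ldots,1$, $\alpha_{i_t}$ is any integer with $$\alpha_{i_t}\ge \Big(\max_{h\in[k]:\,i_t\in C_h}\ \max_{\ell\in\bar C_h:\,\ell>i_t}\alpha_\ell\Big)+1;$$ then for each $j\in C_0$, $\alpha_j$ is any integer with $$\alpha_j\ge\min_{h\in[k]}\max\Big\{\max_{\ell<j,\ \ell\in\bar C_h}\alpha_\ell,\ \sum_{\ell>j,\ \ell\in\bar C_h}\alpha_\ell+1\Big\};$$ finally $\beta=\max_{h\in[k]}\alpha(C_h)-1$. *)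

theory Defs
  imports "HOL-Analysis.Analysis"
begin

text \<open>The ground set \<open>[n] = {1, ..., n}\<close> is a finite linearly ordered type \<open>'n\<close>; the rows of
  the constraint matrix are indexed by a finite type \<open>'m\<close>.\<close>

definition tomks_data :: "int ^ 'n::{finite,linorder} ^ 'm::finite \<Rightarrow> int ^ 'm \<Rightarrow> bool" where
  "tomks_data A b \<longleftrightarrow>
     (\<forall>r j. 0 \<le> A $ r $ j) \<and> (\<forall>r. 0 \<le> b $ r) \<and>
     (\<forall>i j. i \<le> j \<longrightarrow> (\<forall>r. A $ r $ j \<le> A $ r $ i))"

definition knapsack_set :: "int ^ 'n::finite ^ 'm::finite \<Rightarrow> int ^ 'm \<Rightarrow> (real ^ 'n) set" where
  "knapsack_set A b =
     {x. (\<forall>j. x $ j \<in> {0, 1}) \<and> (\<forall>r. (\<Sum>j\<in>UNIV. of_int (A $ r $ j) * x $ j) \<le> of_int (b $ r))}"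

definition incidence_vec :: "'n set \<Rightarrow> real ^ 'n::finite" where
  "incidence_vec S = (\<chi> i. indicator S i)"

definition cover :: "int ^ 'n::finite ^ 'm::finite \<Rightarrow> int ^ 'm \<Rightarrow> 'n set \<Rightarrow> bool" where
  "cover A b S \<longleftrightarrow> incidence_vec S \<notin> knapsack_set A b"

definition dominates :: "'n::linorder set \<Rightarrow> 'n set \<Rightarrow> bool"  (infix "\<triangleright>" 50) where
  "S1 \<triangleright> S2 \<longleftrightarrow> (\<exists>f. inj_on f S2 \<and> f ` S2 \<subseteq> S1 \<and> (\<forall>i\<in>S2. f i \<le> i))"

text \<open>A family \<open>{C\<^sub>1, ..., C\<^sub>k}\<close> is a set \<open>\<C>\<close> of sets; \<open>C\<^sub>0 = \<Inter>\<C>\<close>, \<open>C = \<Union>\<C>\<close>, and the complement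
  of \<open>H \<in> \<C>\<close> in \<open>C\<close> is \<open>\<Union>\<C> - H\<close>.\<close>

definition discrepancy :: "'n set set \<Rightarrow> 'n set set" where
  "discrepancy \<C> = (\<lambda>H. H - \<Inter>\<C>) ` \<C>"

definition multi_cover ::
  "int ^ 'n::{finite,linorder} ^ 'm::finite \<Rightarrow> int ^ 'm \<Rightarrow> 'n set set \<Rightarrow> bool" where
  "multi_cover A b \<C> \<longleftrightarrow>
     finite \<C> \<and> \<C> \<noteq> {} \<and> (\<forall>H\<in>\<C>. cover A b H) \<and>
     (\<forall>T. T \<subseteq> \<Union>(discrepancy \<C>) \<and> T \<notin> discrepancy \<C> \<longrightarrow>
        (\<exists>D\<in>discrepancy \<C>. T \<triangleright> D \<or> D \<triangleright> T))"

text \<open>Maximum and minimum with the convention that they are \<open>0\<close> on the empty set.\<close>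

definition max0 :: "int set \<Rightarrow> int" where
  "max0 X = (if X = {} then 0 else Max X)"

definition min0 :: "int set \<Rightarrow> int" where
  "min0 X = (if X = {} then 0 else Min X)"

text \<open>The coefficients of the elements of \<open>C - C\<^sub>0\<close> are chosen from the largest element downwards, each
  bound mentioning only the coefficients of larger elements; the bounds for the elements of \<open>C\<^sub>0\<close>
  mention only coefficients of elements of \<open>C - C\<^sub>0\<close>. The vectors the procedure can produce are
  therefore exactly those satisfying all the conditions below simultaneously.\<close>

definition mci :: "'n set set \<Rightarrow> int ^ 'n::{finite,linorder} \<Rightarrow> int \<Rightarrow> bool" where
  "mci \<C> \<alpha> \<beta> \<longleftrightarrow>
     (\<forall>i. i \<notin> \<Union>\<C> \<longrightarrow> \<alpha> $ i = 0) \<and>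
     (\<forall>i \<in> \<Union>\<C> - \<Inter>\<C>.
        if i = Max (\<Union>\<C> - \<Inter>\<C>) then \<alpha> $ i = 1
        else \<alpha> $ i \<ge>
          max0 {max0 {\<alpha> $ l | l. l \<in> \<Union>\<C> - H \<and> l > i} | H. H \<in> \<C> \<and> i \<in> H} + 1) \<and>
     (\<forall>j \<in> \<Inter>\<C>.
        \<alpha> $ j \<ge>
          min0 {max (max0 {\<alpha> $ l | l. l \<in> \<Union>\<C> - H \<and> l < j})
                    ((\<Sum>l | l \<in> \<Union>\<C> - H \<and> l > j. \<alpha> $ l) + 1) | H. H \<in> \<C>}) \<and>
     \<beta> = max0 {(\<Sum>i\<in>H. \<alpha> $ i) | H. H \<in> \<C>} - 1"

end

theory Submission
  imports Defs
begin

text \<open>A \<open>0/1\<close> point is the incidence vector of a set \<open>S\<close>, and a set dominating a cover is a cover.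
  So it suffices to derive from \<open>\<alpha>(S) \<ge> \<alpha>(H)\<close> for all \<open>H \<in> \<C>\<close> that \<open>S\<close> is a cover. If \<open>S\<close> misses some
  \<open>j \<in> \<Inter>\<C>\<close>, the bound on \<open>\<alpha>\<^sub>j\<close> yields an \<open>l < j\<close> in \<open>S - \<Inter>\<C>\<close> with \<open>\<alpha>\<^sub>l \<le> \<alpha>\<^sub>j\<close>; exchanging \<open>l\<close> for \<open>j\<close>
  keeps the hypothesis and produces a set dominated by \<open>S\<close>, so one may assume \<open>\<Inter>\<C> \<subseteq> S\<close>. Then \<open>S - \<Inter>\<C>\<close>
  lies in the discrepancy family, or dominates a member (and \<open>S\<close> is a cover), or is dominated by
  another member \<open>D\<close>; the last case is impossible since it forces \<open>\<alpha>(D) > \<alpha>(S - \<Inter>\<C>)\<close>.\<close>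

section \<open>Dominance between index sets\<close>

lemma dominates_superset: "S2 \<subseteq> S1 \<Longrightarrow> S1 \<triangleright> S2"
  unfolding dominates_def by (rule exI[of _ id]) auto

lemma dominates_exchange:
  fixes S :: "'n::linorder set"
  assumes "l \<in> S" "l < j" "j \<notin> S"
  shows "S \<triangleright> insert j (S - {l})"
  unfolding dominates_def
  by (rule exI[of _ "id(j := l)"]) (use assms in \<open>auto simp: inj_on_def\<close>)

text \<open>The injection is kept on \<open>D - E\<close> and replaced by the identity on
  \<open>E\<close>; since its values lie in \<open>T\<close>, disjointness from \<open>E\<close>
  prevents collisions.\<close>

lemma dominates_Un:
  fixes D T E :: "'n::linorder set"
  assumes "T \<triangleright> D" "T \<inter> E = {}"
  shows "T \<union> E \<triangleright> D \<union> E"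
proof -
  obtain f where f: "inj_on f D" "f ` D \<subseteq> T" "\<forall>i\<in>D. f i \<le> i"
    using assms(1) unfolding dominates_def by blast
  let ?g = "\<lambda>i. if i \<in> E then i else f i"
  have "inj_on ?g (D \<union> E)"
  proof (rule inj_onI)
    fix x y assume xy: "x \<in> D \<union> E" "y \<in> D \<union> E" "?g x = ?g y"
    have "f z \<notin> E" if "z \<in> D" for z using f(2) assms(2) that by blast
    then show "x = y" using xy f(1) by (auto dest: inj_onD split: if_splits)
  qed
  moreover have "?g ` (D \<union> E) \<subseteq> T \<union> E"
    using f(2) by auto
  moreover have "\<forall>i\<in>D \<union> E. ?g i \<le> i"
    using f(3) by (metis UnE order_refl)
  ultimately show ?thesis unfolding dominates_def by blast
qed

lemma dominates_remove:
  fixes S1 S2 :: "'n::linorder set"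
  assumes "S1 \<triangleright> S2" "x \<in> S2"
  shows "S1 - {x} \<triangleright> S2 - {x}"
proof -
  obtain f where f: "inj_on f S2" "f ` S2 \<subseteq> S1" "\<forall>i\<in>S2. f i \<le> i"
    using assms(1) unfolding dominates_def by blast
  \<comment> \<open>The element sent to \<open>x\<close>, if any, is rerouted to \<open>f x\<close>,
    a value freed by dropping \<open>x\<close> from the domain. The order bound survives because
    \<open>f x \<le> x = f i \<le> i\<close>.\<close>
  let ?g = "\<lambda>i. if f i = x then f x else f i"
  have "inj_on ?g (S2 - {x})"
    using f(1) assms(2) unfolding inj_on_def by (metis Diff_iff singletonI)
  moreover have "?g ` (S2 - {x}) \<subseteq> S1 - {x}"
    using f(1,2) assms(2) unfolding inj_on_def by auto
  moreover have "\<forall>i\<in>S2 - {x}. ?g i \<le> i"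
    using f(3) assms(2) by (auto intro: order_trans)
  ultimately show ?thesis unfolding dominates_def by blast
qed

text \<open>Cancels the common part of two sets, so that the injection can be taken between their
  differences.\<close>

lemma dominates_Diff:
  fixes S1 S2 :: "'n::linorder set"
  assumes "finite E" "S1 \<triangleright> S2" "E \<subseteq> S2"
  shows "S1 - E \<triangleright> S2 - E"
  using assms(1,3)
proof (induction E)
  case empty
  then show ?case using assms(2) by simp
next
  case (insert x E)
  have "S1 - E - {x} \<triangleright> S2 - E - {x}"
    using insert by (intro dominates_remove) auto
  then show ?case by (simp only: Diff_insert[of _ x E])
qed

text \<open>After cancelling \<open>D \<inter> T\<close>, each element of \<open>T - D\<close> is
  matched with a smaller index in \<open>D - T\<close>, which weighs more by \<open>dec\<close>;
  unmatched elements of \<open>D - T\<close> only add weight by \<open>pos\<close>.\<close>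

lemma dominates_sum_strict:
  fixes D T :: "'n::linorder set" and w :: "'n \<Rightarrow> int"
  assumes fin: "finite D" "finite T" and dom: "D \<triangleright> T" and ne: "T \<noteq> D"
    and pos: "\<And>i. i \<in> D - T \<Longrightarrow> 0 < w i"
    and dec: "\<And>i l. i \<in> D - T \<Longrightarrow> l \<in> T - D \<Longrightarrow> i < l \<Longrightarrow> w l < w i"
  shows "sum w T < sum w D"
proof -
  have "D - D \<inter> T \<triangleright> T - D \<inter> T"
    using fin dom by (intro dominates_Diff) auto
  moreover have "D - D \<inter> T = D - T" "T - D \<inter> T = T - D" by auto
  ultimately obtain f where f: "inj_on f (T - D)" "f ` (T - D) \<subseteq> D - T" "\<forall>i\<in>T - D. f i \<le> i"
    unfolding dominates_def by auto
  have less: "w i < w (f i)" if "i \<in> T - D" for i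
  proof (rule dec)
    show "f i \<in> D - T" "i \<in> T - D" using f(2) that by auto
    \<comment> \<open>Equality is excluded because \<open>f i\<close> and \<open>i\<close> lie in
      disjoint sets.\<close>
    then show "f i < i" using f(3) by (metis DiffD1 DiffD2 order_le_less)
  qed
  have le: "(\<Sum>i\<in>T - D. w (f i)) \<le> sum w (D - T)"
  proof -
    have "(\<Sum>i\<in>T - D. w (f i)) = sum w (f ` (T - D))"
      using f(1) by (simp add: sum.reindex)
    also have "\<dots> \<le> sum w (D - T)"
      using fin f(2) pos by (intro sum_mono2) (auto intro: less_imp_le)
    finally show ?thesis .
  qed
  have "sum w (T - D) < sum w (D - T)"
  \<comment> \<open>With nothing to match, strictness comes from the positive weight of the nonempty
    \<open>D - T\<close>.\<close>
  proof (cases "T - D = {}")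
    case True
    then have "D - T \<noteq> {}" using ne by auto
    then have "0 < sum w (D - T)" using fin pos by (intro sum_pos) auto
    then show ?thesis by (simp only: True sum.empty)
  next
    case False
    then have "sum w (T - D) < (\<Sum>i\<in>T - D. w (f i))"
      using fin less by (intro sum_strict_mono) auto
    then show ?thesis using le by simp
  qed
  moreover have "sum w T = sum w (T \<inter> D) + sum w (T - D)"
    "sum w D = sum w (D \<inter> T) + sum w (D - T)"
    using fin by (auto intro: sum.Int_Diff)
  ultimately show ?thesis by (simp only: Int_commute[of D T] add_less_cancel_left)
qed

section \<open>Covers and dominance\<close>

lemma incidence_vec_in_knapsack_iff:
  "incidence_vec S \<in> knapsack_set A b \<longleftrightarrow> (\<forall>r. (\<Sum>j\<in>S. A $ r $ j) \<le> b $ r)"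
proof -
  have "(\<Sum>j\<in>UNIV. of_int (A $ r $ j) * incidence_vec S $ j) = (of_int (\<Sum>j\<in>S. A $ r $ j) :: real)" for r
    by (simp add: incidence_vec_def sum.If_cases indicator_def of_bool_def if_distrib cong: if_cong)
  moreover have "incidence_vec S $ j \<in> {0, 1}" for j
    by (simp add: incidence_vec_def indicator_def)
  ultimately show ?thesis
    unfolding knapsack_set_def by (simp del: of_int_sum)
qed

text \<open>Columns decrease with the index, so moving elements to smaller indices cannot lower any
  row sum, and further elements add nonnegative entries: a row violated by \<open>S2\<close> is
  violated by \<open>S1\<close>.\<close>

lemma cover_dominates:
  assumes "tomks_data A b" "S1 \<triangleright> S2" "cover A b S2"
  shows "cover A b S1"
proof -
  obtain f where f: "inj_on f S2" "f ` S2 \<subseteq> S1" "\<forall>i\<in>S2. f i \<le> i"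
    using assms(2) unfolding dominates_def by blast
  obtain r where r: "b $ r < (\<Sum>j\<in>S2. A $ r $ j)"
    using assms(3) unfolding cover_def incidence_vec_in_knapsack_iff by (auto simp: not_le)
  have "(\<Sum>j\<in>S2. A $ r $ j) \<le> (\<Sum>j\<in>S2. A $ r $ f j)"
    using assms(1) f(3) unfolding tomks_data_def by (intro sum_mono) blast
  also have "\<dots> = (\<Sum>j\<in>f ` S2. A $ r $ j)"
    using f(1) by (simp add: sum.reindex)
  also have "\<dots> \<le> (\<Sum>j\<in>S1. A $ r $ j)"
    using assms(1) f(2) unfolding tomks_data_def by (intro sum_mono2) auto
  finally have "b $ r < (\<Sum>j\<in>S1. A $ r $ j)" using r by simp
  then show ?thesis
    unfolding cover_def incidence_vec_in_knapsack_iff by (auto simp: not_le)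
qed

section \<open>Consequences of the coefficient bounds\<close>

lemma max0_ge: "finite X \<Longrightarrow> x \<in> X \<Longrightarrow> x \<le> max0 X"
  by (auto simp: max0_def)

lemma max0_nonneg: "finite X \<Longrightarrow> (\<And>x. x \<in> X \<Longrightarrow> 0 \<le> x) \<Longrightarrow> 0 \<le> max0 X"
  by (auto simp: max0_def)

lemma min0_in: "finite X \<Longrightarrow> X \<noteq> {} \<Longrightarrow> min0 X \<in> X"
  by (auto simp: min0_def)

lemma mci_bound_discrepancy:
  assumes "mci \<C> \<alpha> \<beta>" "i \<in> \<Union>\<C> - \<Inter>\<C>" "i \<noteq> Max (\<Union>\<C> - \<Inter>\<C>)"
  shows "max0 {max0 {\<alpha> $ l | l. l \<in> \<Union>\<C> - H \<and> l > i} | H. H \<in> \<C> \<and> i \<in> H} + 1 \<le> \<alpha> $ i"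
proof -
  have "\<forall>i \<in> \<Union>\<C> - \<Inter>\<C>. if i = Max (\<Union>\<C> - \<Inter>\<C>) then \<alpha> $ i = 1 else \<alpha> $ i \<ge>
          max0 {max0 {\<alpha> $ l | l. l \<in> \<Union>\<C> - H \<and> l > i} | H. H \<in> \<C> \<and> i \<in> H} + 1"
    using assms(1) unfolding mci_def by (elim conjE)
  from bspec[OF this assms(2)] assms(3) show ?thesis by (simp only: if_False)
qed

lemma mci_pos_discrepancy:
  fixes \<C> :: "'n::{finite,linorder} set set"
  assumes mci: "mci \<C> \<alpha> \<beta>" and i: "i \<in> \<Union>\<C> - \<Inter>\<C>"
  shows "0 < \<alpha> $ i"
proof -
  \<comment> \<open>The induction runs from the largest index downwards, the order in which the
    coefficients are chosen.\<close>
  have "wf {(x, y :: 'n). y < x}"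
    by (rule finite_acyclic_wf)
       (auto intro!: acyclicI_order[of _ id] finite_subset[OF subset_UNIV] simp: prod_eq_iff)
  then show ?thesis using i
  proof (induction i)
    case (less i)
    show ?case
    proof (cases "i = Max (\<Union>\<C> - \<Inter>\<C>)")
      case True
      then show ?thesis using mci less.prems unfolding mci_def by auto
    next
      case False
      have "0 \<le> max0 {max0 {\<alpha> $ l | l. l \<in> \<Union>\<C> - H \<and> l > i} | H. H \<in> \<C> \<and> i \<in> H}"
      proof (rule max0_nonneg)
        fix x assume "x \<in> {max0 {\<alpha> $ l | l. l \<in> \<Union>\<C> - H \<and> l > i} | H. H \<in> \<C> \<and> i \<in> H}"
        then obtain H where H: "H \<in> \<C>" "x = max0 {\<alpha> $ l | l. l \<in> \<Union>\<C> - H \<and> l > i}" by blast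
        \<comment> \<open>An \<open>l\<close> outside \<open>H\<close> is also outside
          \<open>\<Inter>\<C>\<close>, so the induction hypothesis covers all competing
          coefficients; an empty maximum is \<open>0\<close>.\<close>
        show "0 \<le> x" unfolding H(2)
          by (rule max0_nonneg) (use H(1) less.IH in \<open>fastforce intro: less_imp_le\<close>)+
      qed simp
      then show ?thesis using mci_bound_discrepancy[OF mci less.prems False] by linarith
    qed
  qed
qed

lemma mci_decreasing_discrepancy:
  fixes \<C> :: "'n::{finite,linorder} set set"
  assumes mci: "mci \<C> \<alpha> \<beta>" and H: "H \<in> \<C>" and i: "i \<in> H - \<Inter>\<C>" and l: "l \<in> \<Union>\<C> - H"
    and "i < l"
  shows "\<alpha> $ l < \<alpha> $ i"
proof -
  \<comment> \<open>The larger \<open>l\<close> also lies in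
    \<open>\<Union>\<C> - \<Inter>\<C>\<close>, so \<open>i\<close> is not its maximum and the
    inequality branch of \<open>mci\<close> applies.\<close>
  have "l \<le> Max (\<Union>\<C> - \<Inter>\<C>)"
    using H l by (intro Max_ge) auto
  then have "i \<noteq> Max (\<Union>\<C> - \<Inter>\<C>)" using \<open>i < l\<close> by auto
  then have bound: "max0 {max0 {\<alpha> $ l | l. l \<in> \<Union>\<C> - H \<and> l > i} | H. H \<in> \<C> \<and> i \<in> H} + 1 \<le> \<alpha> $ i"
    using mci H i by (intro mci_bound_discrepancy) auto
  have "\<alpha> $ l \<le> max0 {\<alpha> $ l | l. l \<in> \<Union>\<C> - H \<and> l > i}"
    by (rule max0_ge) (use l \<open>i < l\<close> in auto)
  also have "\<dots> \<le> max0 {max0 {\<alpha> $ l | l. l \<in> \<Union>\<C> - H \<and> l > i} | H. H \<in> \<C> \<and> i \<in> H}"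
    by (rule max0_ge) (use H i in auto)
  finally show ?thesis using bound by linarith
qed

text \<open>\<open>H\<close> is a member attaining the minimum over the family. The
  \<open>+ 1\<close> in the bound makes the sum estimate strict.\<close>

lemma mci_bound_Inter:
  fixes \<C> :: "'n::{finite,linorder} set set"
  assumes mci: "mci \<C> \<alpha> \<beta>" and "\<C> \<noteq> {}" and j: "j \<in> \<Inter>\<C>"
  obtains H where "H \<in> \<C>" "\<And>l. l \<in> \<Union>\<C> - H \<Longrightarrow> l < j \<Longrightarrow> \<alpha> $ l \<le> \<alpha> $ j"
    "(\<Sum>l | l \<in> \<Union>\<C> - H \<and> l > j. \<alpha> $ l) < \<alpha> $ j"
proof -
  let ?X = "{max (max0 {\<alpha> $ l | l. l \<in> \<Union>\<C> - H \<and> l < j})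
              ((\<Sum>l | l \<in> \<Union>\<C> - H \<and> l > j. \<alpha> $ l) + 1) | H. H \<in> \<C>}"
  have "\<forall>j \<in> \<Inter>\<C>. \<alpha> $ j \<ge> min0 {max (max0 {\<alpha> $ l | l. l \<in> \<Union>\<C> - H \<and> l < j})
              ((\<Sum>l | l \<in> \<Union>\<C> - H \<and> l > j. \<alpha> $ l) + 1) | H. H \<in> \<C>}"
    using mci unfolding mci_def by (elim conjE)
  from bspec[OF this j] have "min0 ?X \<le> \<alpha> $ j" .
  moreover have "min0 ?X \<in> ?X" using \<open>\<C> \<noteq> {}\<close> by (intro min0_in) auto
  ultimately obtain H where H: "H \<in> \<C>" "max0 {\<alpha> $ l | l. l \<in> \<Union>\<C> - H \<and> l < j} \<le> \<alpha> $ j"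
    "(\<Sum>l | l \<in> \<Union>\<C> - H \<and> l > j. \<alpha> $ l) + 1 \<le> \<alpha> $ j"
    by (smt (verit) mem_Collect_eq)
  show thesis
  proof (rule that[OF H(1)])
    fix l assume "l \<in> \<Union>\<C> - H" "l < j"
    then have "\<alpha> $ l \<le> max0 {\<alpha> $ l | l. l \<in> \<Union>\<C> - H \<and> l < j}"
      by (intro max0_ge) auto
    then show "\<alpha> $ l \<le> \<alpha> $ j" using H(2) by linarith
  qed (use H(3) in linarith)
qed

lemma mci_nonneg:
  fixes \<C> :: "'n::{finite,linorder} set set"
  assumes mci: "mci \<C> \<alpha> \<beta>" and ne: "\<C> \<noteq> {}"
  shows "0 \<le> \<alpha> $ i"
proof -
  consider "i \<notin> \<Union>\<C>" | "i \<in> \<Union>\<C> - \<Inter>\<C>" | "i \<in> \<Inter>\<C>" by blast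
  then show ?thesis
  proof cases
    case 1
    then show ?thesis using mci unfolding mci_def by simp
  next
    case 2
    then show ?thesis using mci_pos_discrepancy[OF mci] by (simp add: less_imp_le)
  next
    case 3
    then obtain H where H: "H \<in> \<C>" "(\<Sum>l | l \<in> \<Union>\<C> - H \<and> l > i. \<alpha> $ l) < \<alpha> $ i"
      using mci_bound_Inter[OF mci ne] by metis
    \<comment> \<open>Each summand belongs to an element outside \<open>H\<close>, hence outside
      \<open>\<Inter>\<C>\<close>, where coefficients are positive.\<close>
    have "0 \<le> (\<Sum>l | l \<in> \<Union>\<C> - H \<and> l > i. \<alpha> $ l)"
      by (rule sum_nonneg) (use H(1) in \<open>auto intro!: less_imp_le mci_pos_discrepancy[OF mci]\<close>)
    then show ?thesis using H(2) by linarith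
  qed
qed

section \<open>Sets at least as heavy as every member of the family\<close>

lemma cover_if_weight_ge_superset_Inter:
  fixes A :: "int ^ 'n::{finite,linorder} ^ 'm::finite"
  assumes td: "tomks_data A b" and mc: "multi_cover A b \<C>" and mci: "mci \<C> \<alpha> \<beta>"
    and S: "S \<subseteq> \<Union>\<C>" "\<Inter>\<C> \<subseteq> S"
    and heavy: "\<And>H. H \<in> \<C> \<Longrightarrow> (\<Sum>i\<in>H. \<alpha> $ i) \<le> (\<Sum>i\<in>S. \<alpha> $ i)"
  shows "cover A b S"
proof -
  define T where "T = S - \<Inter>\<C>"
  have cov: "cover A b H" if "H \<in> \<C>" for H
    using mc that unfolding multi_cover_def by blast
  have split: "X = (X - \<Inter>\<C>) \<union> \<Inter>\<C>" if "\<Inter>\<C> \<subseteq> X" for X using that by blast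
  show ?thesis
  proof (cases "T \<in> discrepancy \<C>")
    case True
    then obtain H where "H \<in> \<C>" "T = H - \<Inter>\<C>" unfolding discrepancy_def by blast
    then have "S = H" using S(2) unfolding T_def by blast
    then show ?thesis using cov \<open>H \<in> \<C>\<close> by simp
  next
    case False
    have "T \<subseteq> \<Union>(discrepancy \<C>)" using S(1) unfolding T_def discrepancy_def by auto
    with False obtain D where D: "D \<in> discrepancy \<C>" "T \<triangleright> D \<or> D \<triangleright> T"
      using mc unfolding multi_cover_def by blast
    then obtain H where H: "H \<in> \<C>" "D = H - \<Inter>\<C>" unfolding discrepancy_def by blast
    have "\<not> D \<triangleright> T"
    proof
      assume "D \<triangleright> T"
      have "(\<Sum>i\<in>T. \<alpha> $ i) < (\<Sum>i\<in>D. \<alpha> $ i)"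
      proof (rule dominates_sum_strict)
        show "T \<noteq> D" using False D(1) by blast
        show "0 < \<alpha> $ i" if "i \<in> D - T" for i
          using that H by (intro mci_pos_discrepancy[OF mci]) auto
        show "\<alpha> $ l < \<alpha> $ i" if "i \<in> D - T" "l \<in> T - D" "i < l" for i l
          \<comment> \<open>An element of \<open>T - D\<close> avoids \<open>\<Inter>\<C>\<close>
            and \<open>D = H - \<Inter>\<C>\<close>, hence all of \<open>H\<close>.\<close>
          by (rule mci_decreasing_discrepancy[OF mci H(1)]) (use that H S(1) in \<open>auto simp: T_def\<close>)
      qed (use \<open>D \<triangleright> T\<close> in auto)
      moreover have "(\<Sum>i\<in>S. \<alpha> $ i) = (\<Sum>i\<in>T. \<alpha> $ i) + (\<Sum>i\<in>\<Inter>\<C>. \<alpha> $ i)"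
        unfolding T_def using S(2) by (intro sum.subset_diff) auto
      moreover have "(\<Sum>i\<in>H. \<alpha> $ i) = (\<Sum>i\<in>D. \<alpha> $ i) + (\<Sum>i\<in>\<Inter>\<C>. \<alpha> $ i)"
        unfolding H(2) using H(1) by (intro sum.subset_diff) auto
      ultimately show False using heavy[OF H(1)] by linarith
    qed
    \<comment> \<open>Only \<open>T \<triangleright> D\<close> remains; restoring the common part
      \<open>\<Inter>\<C>\<close> turns it into \<open>S \<triangleright> H\<close>.\<close>
    then have "T \<union> \<Inter>\<C> \<triangleright> D \<union> \<Inter>\<C>"
      using D(2) by (intro dominates_Un) (auto simp: T_def)
    then have "S \<triangleright> H"
      using split[OF S(2)] split[of H] H unfolding T_def by (metis Inter_lower)
    then show ?thesis using cover_dominates[OF td] cov H(1) by blast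
  qed
qed

text \<open>Take \<open>H\<close> attaining the bound for \<open>j\<close>. If \<open>S - H\<close>
  had no index below \<open>j\<close>, its weight would be less than \<open>\<alpha> $ j\<close>,
  hence less than that of \<open>H - S\<close>, which contains \<open>j\<close>; then
  \<open>S\<close> would be lighter than \<open>H\<close>.\<close>

lemma mci_exchange:
  fixes \<C> :: "'n::{finite,linorder} set set"
  assumes mci: "mci \<C> \<alpha> \<beta>" and ne: "\<C> \<noteq> {}" and S: "S \<subseteq> \<Union>\<C>" and j: "j \<in> \<Inter>\<C> - S"
    and heavy: "\<And>H. H \<in> \<C> \<Longrightarrow> (\<Sum>i\<in>H. \<alpha> $ i) \<le> (\<Sum>i\<in>S. \<alpha> $ i)"
  obtains l where "l \<in> S - \<Inter>\<C>" "l < j" "\<alpha> $ l \<le> \<alpha> $ j"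
proof -
  obtain H where H: "H \<in> \<C>" "\<And>l. l \<in> \<Union>\<C> - H \<Longrightarrow> l < j \<Longrightarrow> \<alpha> $ l \<le> \<alpha> $ j"
    "(\<Sum>l | l \<in> \<Union>\<C> - H \<and> l > j. \<alpha> $ l) < \<alpha> $ j"
    using mci_bound_Inter[OF mci ne] j by (metis DiffD1)
  have "\<exists>l\<in>S - H. l < j"
  proof (rule ccontr)
    assume none: "\<not> (\<exists>l\<in>S - H. l < j)"
    have "S - H \<subseteq> {l. l \<in> \<Union>\<C> - H \<and> l > j}"
    proof
      fix l assume l: "l \<in> S - H"
      moreover have "l \<noteq> j" using l j by blast
      ultimately show "l \<in> {l. l \<in> \<Union>\<C> - H \<and> l > j}"
        using none S linorder_less_linear[of l j] by blast
    qed
    then have "(\<Sum>i\<in>S - H. \<alpha> $ i) \<le> (\<Sum>l | l \<in> \<Union>\<C> - H \<and> l > j. \<alpha> $ l)"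
      by (intro sum_mono2) (auto intro: mci_nonneg[OF mci ne])
    also have "\<dots> < \<alpha> $ j" by (fact H(3))
    also have "\<dots> \<le> (\<Sum>i\<in>H - S. \<alpha> $ i)"
      using j H(1) by (intro member_le_sum) (auto intro: mci_nonneg[OF mci ne])
    finally have "(\<Sum>i\<in>S - H. \<alpha> $ i) < (\<Sum>i\<in>H - S. \<alpha> $ i)" .
    moreover have "(\<Sum>i\<in>S. \<alpha> $ i) = (\<Sum>i\<in>S \<inter> H. \<alpha> $ i) + (\<Sum>i\<in>S - H. \<alpha> $ i)"
      "(\<Sum>i\<in>H. \<alpha> $ i) = (\<Sum>i\<in>H \<inter> S. \<alpha> $ i) + (\<Sum>i\<in>H - S. \<alpha> $ i)"
      by (rule sum.Int_Diff, simp)+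
    ultimately show False using heavy[OF H(1)] by (simp only: Int_commute[of H S])
  qed
  then obtain l where l: "l \<in> S - H" "l < j" by blast
  show thesis
  proof (rule that)
    show "l \<in> S - \<Inter>\<C>" using l(1) H(1) by blast
    show "\<alpha> $ l \<le> \<alpha> $ j" by (rule H(2)) (use l S in auto)
  qed (fact l(2))
qed

lemma cover_if_weight_ge:
  fixes A :: "int ^ 'n::{finite,linorder} ^ 'm::finite"
  assumes td: "tomks_data A b" and mc: "multi_cover A b \<C>" and mci: "mci \<C> \<alpha> \<beta>"
    and "S \<subseteq> \<Union>\<C>" "\<And>H. H \<in> \<C> \<Longrightarrow> (\<Sum>i\<in>H. \<alpha> $ i) \<le> (\<Sum>i\<in>S. \<alpha> $ i)"
  shows "cover A b S"
  using assms(4,5)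
\<comment> \<open>Each exchange puts the missing \<open>j\<close> into the set and removes only an
  \<open>l\<close> outside \<open>\<Inter>\<C>\<close>, so the measure drops.\<close>
proof (induction "card (\<Inter>\<C> - S)" arbitrary: S rule: less_induct)
  case less
  have ne: "\<C> \<noteq> {}" using mc unfolding multi_cover_def by blast
  show ?case
  proof (cases "\<Inter>\<C> \<subseteq> S")
    case True
    then show ?thesis using cover_if_weight_ge_superset_Inter[OF td mc mci] less.prems by blast
  next
    case False
    then obtain j where j: "j \<in> \<Inter>\<C> - S" by blast
    obtain l where l: "l \<in> S - \<Inter>\<C>" "l < j" "\<alpha> $ l \<le> \<alpha> $ j"
      using mci_exchange[OF mci ne less.prems(1) j less.prems(2)] by blast
    define S' where "S' = insert j (S - {l})"
    have "(\<Sum>i\<in>S. \<alpha> $ i) = \<alpha> $ l + (\<Sum>i\<in>S - {l}. \<alpha> $ i)"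
      using l(1) by (intro sum.remove) auto
    moreover have "(\<Sum>i\<in>S'. \<alpha> $ i) = \<alpha> $ j + (\<Sum>i\<in>S - {l}. \<alpha> $ i)"
      unfolding S'_def using j by (intro sum.insert) auto
    ultimately have le: "(\<Sum>i\<in>S. \<alpha> $ i) \<le> (\<Sum>i\<in>S'. \<alpha> $ i)" using l(3) by linarith
    have "cover A b S'"
    proof (rule less.hyps)
      have "\<Inter>\<C> - S' \<subset> \<Inter>\<C> - S" unfolding S'_def using j l(1) by blast
      then show "card (\<Inter>\<C> - S') < card (\<Inter>\<C> - S)" by (intro psubset_card_mono) auto
      show "S' \<subseteq> \<Union>\<C>" unfolding S'_def using less.prems(1) j ne by blast
      show "(\<Sum>i\<in>H. \<alpha> $ i) \<le> (\<Sum>i\<in>S'. \<alpha> $ i)" if "H \<in> \<C>" for H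
        using less.prems(2)[OF that] le by linarith
    qed
    moreover have "S \<triangleright> S'"
      unfolding S'_def using j l by (intro dominates_exchange) auto
    ultimately show ?thesis using cover_dominates[OF td] by blast
  qed
qed

section \<open>Validity on \<open>K\<close> and on its convex hull\<close>

lemma mci_valid_set:
  fixes A :: "int ^ 'n::{finite,linorder} ^ 'm::finite"
  assumes td: "tomks_data A b" and mc: "multi_cover A b \<C>" and mci: "mci \<C> \<alpha> \<beta>"
    and S: "\<not> cover A b S"
  shows "(\<Sum>i\<in>S. \<alpha> $ i) \<le> \<beta>"
proof (rule ccontr)
  assume "\<not> (\<Sum>i\<in>S. \<alpha> $ i) \<le> \<beta>"
  moreover have "\<beta> = max0 {(\<Sum>i\<in>H. \<alpha> $ i) | H. H \<in> \<C>} - 1"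
    using mci unfolding mci_def by (elim conjE)
  \<comment> \<open>Coefficients vanish outside \<open>\<Union>\<C>\<close>, so \<open>S\<close> can
    be trimmed to \<open>\<Union>\<C>\<close> without changing its weight.\<close>
  moreover have "(\<Sum>i\<in>S \<inter> \<Union>\<C>. \<alpha> $ i) = (\<Sum>i\<in>S. \<alpha> $ i)"
    by (rule sum.mono_neutral_left) (use mci in \<open>auto simp: mci_def\<close>)
  \<comment> \<open>By integrality, exceeding \<open>\<beta>\<close>, the maximum minus
    \<open>1\<close>, means reaching the maximum itself.\<close>
  ultimately have "max0 {(\<Sum>i\<in>H. \<alpha> $ i) | H. H \<in> \<C>} \<le> (\<Sum>i\<in>S \<inter> \<Union>\<C>. \<alpha> $ i)"
    by linarith
  moreover have "(\<Sum>i\<in>H. \<alpha> $ i) \<le> max0 {(\<Sum>i\<in>H. \<alpha> $ i) | H. H \<in> \<C>}" if "H \<in> \<C>" for H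
    by (rule max0_ge) (use that in auto)
  ultimately have "cover A b (S \<inter> \<Union>\<C>)"
    by (intro cover_if_weight_ge[OF td mc mci]) (auto intro: order_trans)
  then show False
    using S cover_dominates[OF td dominates_superset[of "S \<inter> \<Union>\<C>" S]] by blast
qed

theorem theorem1:
  fixes A :: "int ^ 'n::{finite,linorder} ^ 'm::finite" and b :: "int ^ 'm"
    and \<C> :: "'n set set" and \<alpha> :: "int ^ 'n::{finite,linorder}" and \<beta> :: int
  assumes "tomks_data A b"
    and "multi_cover A b \<C>"
    and "mci \<C> \<alpha> \<beta>"
  shows "\<forall>x \<in> convex hull (knapsack_set A b).
           (\<Sum>i\<in>UNIV. of_int (\<alpha> $ i) * x $ i) \<le> of_int \<beta>"
proof -
  define a where "a = (\<chi> i. real_of_int (\<alpha> $ i))"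
  have inner_a: "a \<bullet> x = (\<Sum>i\<in>UNIV. of_int (\<alpha> $ i) * x $ i)" for x
    by (simp add: a_def inner_vec_def)
  \<comment> \<open>A half-space is convex, so checking the points of \<open>K\<close>
    suffices.\<close>
  have "knapsack_set A b \<subseteq> {x. a \<bullet> x \<le> of_int \<beta>}"
  proof
    fix x assume x: "x \<in> knapsack_set A b"
    define S where "S = {i. x $ i = 1}"
    have bin: "x $ i = 0 \<or> x $ i = 1" for i using x unfolding knapsack_set_def by auto
    have xS: "x = incidence_vec S"
      unfolding vec_eq_iff
    proof
      show "x $ i = incidence_vec S $ i" for i
        using bin[of i] by (auto simp: incidence_vec_def S_def)
    qed
    have "a \<bullet> x = (\<Sum>i\<in>S. of_int (\<alpha> $ i))"
      unfolding inner_a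
    proof (rule sum.mono_neutral_cong_right)
      show "\<forall>i\<in>UNIV - S. of_int (\<alpha> $ i) * x $ i = 0"
        using bin by (auto simp: S_def)
    qed (auto simp: S_def)
    moreover have "(\<Sum>i\<in>S. \<alpha> $ i) \<le> \<beta>"
      using x unfolding xS by (intro mci_valid_set[OF assms]) (simp add: cover_def)
    ultimately show "x \<in> {x. a \<bullet> x \<le> of_int \<beta>}"
      by (simp flip: of_int_sum)
  qed
  then have "convex hull (knapsack_set A b) \<subseteq> {x. a \<bullet> x \<le> of_int \<beta>}"
    by (rule hull_minimal) (rule convex_halfspace_le)
  then show ?thesis unfolding inner_a by blast
qed

end
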